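(* Let $1\le n_L\le n$ be integers and let $(\rho,A)\in\mathcal P$ be parameters of the hub model with a null component, with leaders $\{1,\dots,n_L\}$ and nodes $\{1,\dots,n\}$; write $\pi_j=A_{0j}$. Assume: (i) $0<\rho_i<1$ for $i=0,\dots,n_L$; (ii) $A_{ij}<1$ for $i=0,\dots,n_L$, $j=1,\dots,n$, $i\neq j$; (iii) for all $i,i'\in\{1,\dots,n_L\}$ with $i\ne i'$ there exists $k\in\{n_L+1,\dots,n\}$ such that $A_{ik}\neq A_{i'k}$; (iv) for every $i\in\{1,\dots,n_L\}$ there exist two distinct $k,k'\in\{n_L+1,\dots,n\}$ such that $\pi_k\ne A_{ik}$ and $\pi_{k'}\neq A_{ik'}$. Then $(\rho,A)$ is identifiable: for every $(\tilde\rho,\tilde A)\in\mathcal P$, if $\mathbb P(g\mid\tilde\rho,\tilde A)=\mathbb P(g\mid\rho,A)$ for all $g\in\{0,1\}^n$, then $(\tilde\rho,\tilde A)=(\rho,A)$.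
   Context: Hub model with a null component: the nodes are $1,\dots,n$, the possible hubs (leaders) are $1,\dots,n_L$, and the label $0$ denotes a hubless group. The parameter space $\mathcal P$ is the set of pairs $(\rho,A)$ with $\rho=(\rho_0,\rho_1,\dots,\rho_{n_L})$, $0\le\rho_i\le 1$, $\sum_{i=0}^{n_L}\rho_i=1$, and $A=(A_{ij})_{0\le i\le n_L,1\le j\le n}$ with $0\le A_{ij}\le1$ and $A_{ii}=1$ for $i=1,\dots,n_L$; the row $i=0$ is denoted $\pi_j=A_{0j}$ and is unconstrained in $[0,1]$. A single observed group $g=(g_1,\dots,g_n)\in\{0,1\}^n$ has probability $$\mathbb P(g\mid\rho,A)=\sum_{i=0}^{n_L}\rho_i\prod_{j=1}^n A_{ij}^{g_j}(1-A_{ij})^{1-g_j}$$ (with $0^0=1$). Identifiability is in the strict sense (no label swapping allowed); conditions (i)-(iv) are imposed only on $(\rho,A)$, not on $(\tilde\rho,\tilde A)$. *)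

theory Defs
  imports Complex_Main "HOL-Library.FuncSet"
begin

(* Index conventions: row 0 is the hubless (null) component, rows 1..nL are the hubs, columns
   1..n are the nodes.  Vectors and matrices are extensional functions (fixed to the value
   undefined outside their index range), so HOL equality of two parameters is equality of
   exactly the entries that belong to the model. *)

definition hub_params :: "nat \<Rightarrow> nat \<Rightarrow> ((nat \<Rightarrow> real) \<times> (nat \<Rightarrow> nat \<Rightarrow> real)) set" where
  "hub_params n nL =
     {(\<rho>, A). \<rho> \<in> {0..nL} \<rightarrow>\<^sub>E {0..1} \<and> (\<Sum>i=0..nL. \<rho> i) = 1 \<and>
              A \<in> {0..nL} \<rightarrow>\<^sub>E ({1..n} \<rightarrow>\<^sub>E {0..1}) \<and> (\<forall>i\<in>{1..nL}. A i i = 1)}"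

definition hub_groups :: "nat \<Rightarrow> (nat \<Rightarrow> nat) set" where
  "hub_groups n = {1..n} \<rightarrow>\<^sub>E {0, 1}"

(* Exponents are natural numbers, so 0 ^ 0 = 1. *)
definition hub_prob ::
  "nat \<Rightarrow> nat \<Rightarrow> (nat \<Rightarrow> real) \<times> (nat \<Rightarrow> nat \<Rightarrow> real) \<Rightarrow> (nat \<Rightarrow> nat) \<Rightarrow> real" where
  "hub_prob n nL = (\<lambda>(\<rho>, A) g.
     \<Sum>i=0..nL. \<rho> i * (\<Prod>j=1..n. A i j ^ g j * (1 - A i j) ^ (1 - g j)))"

(* Strict identifiability: no relabelling of the components is allowed, and the competing
   parameter ranges over the whole parameter space. *)
definition hub_identifiable ::
  "nat \<Rightarrow> nat \<Rightarrow> (nat \<Rightarrow> real) \<times> (nat \<Rightarrow> nat \<Rightarrow> real) \<Rightarrow> bool" where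
  "hub_identifiable n nL \<theta> \<longleftrightarrow>
     (\<forall>\<theta>'\<in>hub_params n nL.
        (\<forall>g\<in>hub_groups n. hub_prob n nL \<theta>' g = hub_prob n nL \<theta> g) \<longrightarrow> \<theta>' = \<theta>)"

end

theory Submission
  imports Defs
begin

text \<open>Fix the pattern of the hubs present in a group. A hub that is absent rules out its own
  component, so only the null component and the components of the present hubs contribute. With
  no hub present the null component is seen alone, which gives the null row on the non-hub nodes.
  With one hub \<open>i\<close> present we see a mixture of the null row and row \<open>i\<close>; on two nodes where
  these differ, the 2-by-2 table of a combination of both has rank one only if the null row has
  coefficient zero, so both weights and row \<open>i\<close> on the non-hub nodes are determined. With two hubs
  present, condition (iii) makes the two rows linearly independent, so the weights are determined
  again. The entries in the hub columns and the mixing proportions are then read off from ratios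
  of weights.\<close>

text \<open>For disjoint \<open>S\<close> and \<open>Z\<close> inside the node set, this is the
  probability that the group contains all of \<open>S\<close> and nothing of \<open>Z\<close>, the
  other nodes being left free.\<close>

definition hub_moment ::
  "nat \<Rightarrow> (nat \<Rightarrow> real) \<Rightarrow> (nat \<Rightarrow> nat \<Rightarrow> real) \<Rightarrow> nat set \<Rightarrow> nat set \<Rightarrow> real" where
  "hub_moment nL \<rho> A S Z = (\<Sum>i=0..nL. \<rho> i * ((\<Prod>j\<in>S. A i j) * (\<Prod>j\<in>Z. 1 - A i j)))"

text \<open>The joint probability that component \<open>i\<close> is drawn and the hubs present are
  exactly \<open>S\<close>, for \<open>S\<close> a set of hubs.\<close>

definition hub_weight ::
  "nat \<Rightarrow> (nat \<Rightarrow> real) \<Rightarrow> (nat \<Rightarrow> nat \<Rightarrow> real) \<Rightarrow> nat \<Rightarrow> nat set \<Rightarrow> real" where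
  "hub_weight nL \<rho> A i S = \<rho> i * (\<Prod>j\<in>S. A i j) * (\<Prod>j\<in>{1..nL} - S. 1 - A i j)"

lemma hub_moment_split:
  assumes "finite S" "finite Z" "k \<notin> S" "k \<notin> Z"
  shows "hub_moment nL \<rho> A S Z = hub_moment nL \<rho> A (insert k S) Z + hub_moment nL \<rho> A S (insert k Z)"
  using assms by (simp add: hub_moment_def sum.distrib [symmetric] algebra_simps)

lemma hub_moment_eq_hub_prob:
  assumes "S \<union> Z = {1..n}" "S \<inter> Z = {}"
  shows "hub_moment nL \<rho> A S Z = hub_prob n nL (\<rho>, A) (\<lambda>j\<in>{1..n}. if j \<in> S then 1 else 0)"
proof -
  let ?g = "\<lambda>j\<in>{1..n}. if j \<in> S then 1 else (0::nat)"
  have fin: "finite S" "finite Z"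
    using assms(1) by (metis finite_Un finite_atLeastAtMost)+
  have "(\<Prod>j=1..n. A i j ^ ?g j * (1 - A i j) ^ (1 - ?g j))
      = (\<Prod>j\<in>S. A i j) * (\<Prod>j\<in>Z. 1 - A i j)" for i
  proof -
    have "(\<Prod>j=1..n. A i j ^ ?g j * (1 - A i j) ^ (1 - ?g j))
        = (\<Prod>j\<in>S \<union> Z. if j \<in> S then A i j else 1 - A i j)"
      unfolding assms(1) by (rule prod.cong) auto
    also have "\<dots> = (\<Prod>j\<in>S. if j \<in> S then A i j else 1 - A i j)
        * (\<Prod>j\<in>Z. if j \<in> S then A i j else 1 - A i j)"
      using fin assms(2) by (simp add: prod.union_disjoint)
    also have "(\<Prod>j\<in>Z. if j \<in> S then A i j else 1 - A i j) = (\<Prod>j\<in>Z. 1 - A i j)"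
      using assms(2) by (intro prod.cong) auto
    finally show ?thesis by simp
  qed
  then show ?thesis by (simp add: hub_moment_def hub_prob_def)
qed

text \<open>Induction on the number of free nodes: \<open>hub_moment_split\<close> fixes one of them
  either way, down to single groups.\<close>

lemma hub_moment_cong:
  assumes eq: "\<forall>g\<in>hub_groups n. hub_prob n nL (\<rho>', A') g = hub_prob n nL (\<rho>, A) g"
    and "S \<union> Z \<subseteq> {1..n}" "S \<inter> Z = {}"
  shows "hub_moment nL \<rho>' A' S Z = hub_moment nL \<rho> A S Z"
  using assms(2,3)
proof (induction "card ({1..n} - (S \<union> Z))" arbitrary: S Z)
  case 0
  then have "S \<union> Z = {1..n}" by auto
  moreover have "(\<lambda>j\<in>{1..n}. if j \<in> S then 1 else 0) \<in> hub_groups n"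
    by (auto simp: hub_groups_def)
  ultimately show ?case
    using eq 0(3) by (simp only: hub_moment_eq_hub_prob [OF _ 0(3)])
next
  case (Suc m)
  then obtain k where k: "k \<in> {1..n}" "k \<notin> S" "k \<notin> Z"
    by (metis Diff_iff Un_iff card.empty ex_in_conv nat.distinct(1))
  have fin: "finite S" "finite Z"
    using Suc.prems(1) by (meson finite_Un finite_atLeastAtMost finite_subset)+
  have "{1..n} - (insert k S \<union> Z) = {1..n} - (S \<union> Z) - {k}"
    "{1..n} - (S \<union> insert k Z) = {1..n} - (S \<union> Z) - {k}" by auto
  then have "m = card ({1..n} - (insert k S \<union> Z))" "m = card ({1..n} - (S \<union> insert k Z))"
    using Suc.hyps(2) k by simp_all
  then have "hub_moment nL \<rho>' A' (insert k S) Z = hub_moment nL \<rho> A (insert k S) Z"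
    "hub_moment nL \<rho>' A' S (insert k Z) = hub_moment nL \<rho> A S (insert k Z)"
    using Suc.hyps(1) Suc.prems k by auto
  then show ?case
    using hub_moment_split [OF fin k(2,3)] by simp
qed

text \<open>An absent hub \<open>i\<close> removes its own component through the factor
  \<open>1 - A i i = 0\<close>. The nodes of \<open>T\<close> are not hubs, so their entries factor
  out of the weight.\<close>

lemma hub_moment_eq_weights:
  assumes "\<forall>i\<in>{1..nL}. A i i = 1" "S \<subseteq> {1..nL}" "finite T" "T \<inter> {1..nL} = {}"
  shows "hub_moment nL \<rho> A (S \<union> T) ({1..nL} - S)
    = (\<Sum>i\<in>insert 0 S. hub_weight nL \<rho> A i S * (\<Prod>k\<in>T. A i k))"
proof -
  have fin: "finite S" using assms(2) finite_subset by blast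
  have ST: "S \<inter> T = {}" using assms by blast
  have "hub_moment nL \<rho> A (S \<union> T) ({1..nL} - S)
      = (\<Sum>i=0..nL. hub_weight nL \<rho> A i S * (\<Prod>k\<in>T. A i k))"
    unfolding hub_moment_def hub_weight_def
    by (simp add: prod.union_disjoint [OF fin assms(3) ST] mult_ac)
  also have "\<dots> = (\<Sum>i\<in>insert 0 S. hub_weight nL \<rho> A i S * (\<Prod>k\<in>T. A i k))"
  proof (rule sum.mono_neutral_right)
    show "\<forall>i\<in>{0..nL} - insert 0 S. hub_weight nL \<rho> A i S * (\<Prod>k\<in>T. A i k) = 0"
    proof
      fix i assume "i \<in> {0..nL} - insert 0 S"
      then have "i \<in> {1..nL} - S" by auto
      moreover from this have "1 - A i i = 0" using assms(1) by simp
      ultimately have "(\<Prod>j\<in>{1..nL} - S. 1 - A i j) = 0"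
        by (intro prod_zero) auto
      then show "hub_weight nL \<rho> A i S * (\<Prod>k\<in>T. A i k) = 0"
        by (simp add: hub_weight_def)
    qed
  qed (use assms(2) in auto)
  finally show ?thesis .
qed

text \<open>The two weights differ by the odds of \<open>A i j\<close>; the product form also covers
  \<open>A i j = 1\<close>.\<close>

lemma hub_weight_insert:
  assumes "S \<subseteq> {1..nL}" "j \<in> {1..nL} - S"
  shows "hub_weight nL \<rho> A i (insert j S) * (1 - A i j) = hub_weight nL \<rho> A i S * A i j"
proof -
  have fin: "finite S" using assms(1) finite_subset by blast
  have "{1..nL} - S = insert j ({1..nL} - insert j S)" using assms by auto
  then have "(\<Prod>l\<in>{1..nL} - S. 1 - A i l) = (1 - A i j) * (\<Prod>l\<in>{1..nL} - insert j S. 1 - A i l)"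
    by (metis Diff_iff finite_Diff finite_atLeastAtMost insertI1 prod.insert)
  then show ?thesis
    using fin assms by (simp add: hub_weight_def)
qed

lemma hub_weight_nonneg:
  assumes "(\<rho>, A) \<in> hub_params n nL" "nL \<le> n" "i \<in> {0..nL}" "S \<subseteq> {1..nL}"
  shows "0 \<le> hub_weight nL \<rho> A i S"
proof -
  have "\<rho> i \<in> {0..1}" using assms by (auto simp: hub_params_def)
  moreover have "A i j \<in> {0..1}" if "j \<in> {1..nL}" for j
    using assms that by (fastforce simp: hub_params_def PiE_iff)
  ultimately show ?thesis
    using assms(4) by (auto simp: hub_weight_def intro!: mult_nonneg_nonneg prod_nonneg)
qed

text \<open>The two values are both equal to \<open>y / (x + y)\<close>.\<close>

lemma odds_unique:
  fixes x y p q :: real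
  assumes "0 < x" "0 \<le> y" "y * (1 - p) = x * p" "y * (1 - q) = x * q"
  shows "p = q"
proof -
  have "(x + y) * p = (x + y) * q" using assms by (simp add: algebra_simps)
  then show ?thesis using assms by simp
qed

text \<open>The entry is recovered as the probability that hub \<open>j\<close> is present, given
  component \<open>i\<close> and the pattern \<open>S\<close> on the other hubs.\<close>

lemma hub_entry_unique:
  assumes "S \<subseteq> {1..nL}" "j \<in> {1..nL} - S"
    and "hub_weight nL \<rho>' A' i S = hub_weight nL \<rho> A i S"
    and "hub_weight nL \<rho>' A' i (insert j S) = hub_weight nL \<rho> A i (insert j S)"
    and "0 < hub_weight nL \<rho> A i S" "0 \<le> hub_weight nL \<rho> A i (insert j S)"
  shows "A' i j = A i j"
  using odds_unique [OF assms(5,6)] hub_weight_insert [OF assms(1,2)] assms(3,4) by metis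

text \<open>With \<open>c = a - a'\<close>, the hypotheses say that the \<open>2\<times>2\<close> tables
  \<open>c (1, p) (1, p2)\<^sup>T + b (1, q) (1, q2)\<^sup>T\<close> and \<open>b' (1, r) (1, r2)\<^sup>T\<close> agree;
  their determinants are \<open>c b (p - q) (p2 - q2)\<close> and \<open>0\<close>.\<close>

lemma two_point_mixture_unique:
  fixes a a' b b' p p2 q q2 r r2 :: real
  assumes "a + b = a' + b'" "a * p + b * q = a' * p + b' * r"
    and "a * p2 + b * q2 = a' * p2 + b' * r2"
    and "a * (p * p2) + b * (q * q2) = a' * (p * p2) + b' * (r * r2)"
    and "b \<noteq> 0" "p \<noteq> q" "p2 \<noteq> q2"
  shows "a' = a" "b' = b"
proof -
  define c where "c = a - a'"
  have e: "c + b = b'" "c * p + b * q = b' * r" "c * p2 + b * q2 = b' * r2"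
    "c * (p * p2) + b * (q * q2) = b' * (r * r2)"
    using assms(1-4) by (simp_all add: c_def algebra_simps)
  have "c * b * ((p - q) * (p2 - q2))
      = (c + b) * (c * (p * p2) + b * (q * q2)) - (c * p + b * q) * (c * p2 + b * q2)"
    by (simp add: algebra_simps)
  also have "\<dots> = 0" unfolding e by simp
  finally have "c = 0" using assms(5-7) by simp
  then show "a' = a" "b' = b" using e(1) by (auto simp: c_def)
qed

lemma two_point_weights_unique:
  fixes x x' y y' p q :: real
  assumes "x + y = x' + y'" "x * p + y * q = x' * p + y' * q" "p \<noteq> q"
  shows "x' = x"
proof -
  \<comment> \<open>Subtracting \<open>q\<close> times the first equation from the second eliminates
    \<open>y\<close> and \<open>y'\<close>.\<close>
  have "(x - x') * (p - q) = 0"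
    using assms(1,2) by algebra
  then show ?thesis using assms(3) by simp
qed

theorem theorem6:
  fixes n nL :: nat and \<rho> :: "nat \<Rightarrow> real" and A :: "nat \<Rightarrow> nat \<Rightarrow> real"
  assumes "1 \<le> nL" and "nL \<le> n"
    and "(\<rho>, A) \<in> hub_params n nL"
    and "\<forall>i\<in>{0..nL}. 0 < \<rho> i \<and> \<rho> i < 1"
    and "\<forall>i\<in>{0..nL}. \<forall>j\<in>{1..n}. i \<noteq> j \<longrightarrow> A i j < 1"
    and "\<forall>i\<in>{1..nL}. \<forall>i'\<in>{1..nL}. i \<noteq> i' \<longrightarrow> (\<exists>k\<in>{nL+1..n}. A i k \<noteq> A i' k)"
    and "\<forall>i\<in>{1..nL}. \<exists>k\<in>{nL+1..n}. \<exists>k'\<in>{nL+1..n}.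
           k \<noteq> k' \<and> A 0 k \<noteq> A i k \<and> A 0 k' \<noteq> A i k'"
  shows "hub_identifiable n nL (\<rho>, A)"
  unfolding hub_identifiable_def
proof (intro ballI impI)
  fix \<theta>' assume "\<theta>' \<in> hub_params n nL"
    and "\<forall>g\<in>hub_groups n. hub_prob n nL \<theta>' g = hub_prob n nL (\<rho>, A) g"
  then obtain \<rho>' A' where \<theta>': "\<theta>' = (\<rho>', A')" and par': "(\<rho>', A') \<in> hub_params n nL"
    and eq: "\<forall>g\<in>hub_groups n. hub_prob n nL (\<rho>', A') g = hub_prob n nL (\<rho>, A) g"
    by (cases \<theta>') auto
  note par = assms(3)
  have diag: "\<forall>i\<in>{1..nL}. A i i = 1" "\<forall>i\<in>{1..nL}. A' i i = 1"
    using par par' by (auto simp: hub_params_def)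
  let ?w = "hub_weight nL \<rho> A" and ?w' = "hub_weight nL \<rho>' A'"

  \<comment> \<open>Equality of the two distributions enters the rest of the proof only through this
    identity.\<close>
  have mix: "(\<Sum>i\<in>insert 0 S. ?w' i S * (\<Prod>k\<in>T. A' i k)) = (\<Sum>i\<in>insert 0 S. ?w i S * (\<Prod>k\<in>T. A i k))"
    if "S \<subseteq> {1..nL}" "T \<subseteq> {nL+1..n}" for S T
  proof -
    have T: "finite T" "T \<inter> {1..nL} = {}" using that(2) finite_subset by fastforce+
    have "S \<union> T \<union> ({1..nL} - S) \<subseteq> {1..n}" "(S \<union> T) \<inter> ({1..nL} - S) = {}"
      using that T assms(2) by fastforce+
    from hub_moment_cong [OF eq this] show ?thesis
      using hub_moment_eq_weights [where A = A, OF diag(1) that(1) T]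
        hub_moment_eq_weights [where A = A', OF diag(2) that(1) T] by simp
  qed

  have nonneg: "0 \<le> ?w i S" if "i \<in> {0..nL}" "S \<subseteq> {1..nL}" for i S
    using hub_weight_nonneg [OF par assms(2) that] .
  have absent_pos: "0 < (\<Prod>j\<in>{1..nL} - {i}. 1 - A i j)" if "i \<in> {0..nL}" for i
    using assms(2,5) that by (intro prod_pos) auto
  \<comment> \<open>A present hub other than \<open>i\<close> contributes an entry of row
    \<open>i\<close> that may be 0, so positivity is claimed for these patterns alone.\<close>
  have pos0: "0 < ?w 0 {}"
    using absent_pos [of 0] assms(4) by (simp add: hub_weight_def)
  have pos: "0 < ?w i {i}" if "i \<in> {1..nL}" for i
    using absent_pos [of i] assms(4) diag(1) that by (simp add: hub_weight_def)

  have w0: "?w' 0 {} = ?w 0 {}" using mix [of "{}" "{}"] by simp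
  have null: "A' 0 k = A 0 k" if "k \<in> {nL+1..n}" for k
    using mix [of "{}" "{k}"] that w0 pos0 by simp

  have single: "?w' 0 {i} = ?w 0 {i} \<and> ?w' i {i} = ?w i {i}" if i: "i \<in> {1..nL}" for i
  proof -
    obtain k k' where k: "k \<in> {nL+1..n}" "k' \<in> {nL+1..n}" "k \<noteq> k'"
      "A 0 k \<noteq> A i k" "A 0 k' \<noteq> A i k'"
      using assms(7) i by blast
    \<comment> \<open>The choices \<open>{}\<close>, \<open>{k}\<close>, \<open>{k'}\<close>,
      \<open>{k, k'}\<close> of \<open>T\<close> fill the 2-by-2 table. By \<open>null\<close> both
      sides share the null entries, while row \<open>i\<close> of \<open>A'\<close> is still
      unknown.\<close>
    have "i \<noteq> 0" using i by simp
    then have "?w 0 {i} + ?w i {i} = ?w' 0 {i} + ?w' i {i}"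
      "?w 0 {i} * A 0 k + ?w i {i} * A i k = ?w' 0 {i} * A 0 k + ?w' i {i} * A' i k"
      "?w 0 {i} * A 0 k' + ?w i {i} * A i k' = ?w' 0 {i} * A 0 k' + ?w' i {i} * A' i k'"
      "?w 0 {i} * (A 0 k * A 0 k') + ?w i {i} * (A i k * A i k')
        = ?w' 0 {i} * (A 0 k * A 0 k') + ?w' i {i} * (A' i k * A' i k')"
      using mix [of "{i}" "{}"] mix [of "{i}" "{k}"] mix [of "{i}" "{k'}"] mix [of "{i}" "{k, k'}"]
        i k(1-3) null [OF k(1)] null [OF k(2)] by simp_all
    from two_point_mixture_unique [OF this _ k(4,5)] pos [OF i] show ?thesis by simp
  qed

  have row: "A' i k = A i k" if i: "i \<in> {1..nL}" and k: "k \<in> {nL+1..n}" for i k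
    using mix [of "{i}" "{k}"] i k single [OF i] pos [OF i] null [OF k] by simp

  have null_hub: "A' 0 j = A 0 j" if "j \<in> {1..nL}" for j
    using hub_entry_unique [of "{}" nL j \<rho>' A' 0 \<rho> A]
      that w0 single [OF that] pos0 nonneg [of 0 "{j}"] by simp
  \<comment> \<open>With the null row known on the hubs, null weights can differ only by the ratio
    of \<open>\<rho>' 0\<close> to \<open>\<rho> 0\<close>; the empty pattern shows that this ratio
    is 1.\<close>
  have scale: "?w' 0 S * \<rho> 0 = \<rho>' 0 * ?w 0 S" if "S \<subseteq> {1..nL}" for S
  proof -
    have "(\<Prod>j\<in>S. A' 0 j) = (\<Prod>j\<in>S. A 0 j)"
      using that null_hub by (intro prod.cong) auto
    moreover have "(\<Prod>j\<in>{1..nL} - S. 1 - A' 0 j) = (\<Prod>j\<in>{1..nL} - S. 1 - A 0 j)"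
      using null_hub by (intro prod.cong) auto
    ultimately show ?thesis by (simp add: hub_weight_def)
  qed
  have \<rho>0: "\<rho>' 0 = \<rho> 0"
    using scale [of "{}"] w0 pos0 by simp
  have "0 < \<rho> 0" using assms(4) by simp
  then have null_weight: "?w' 0 S = ?w 0 S" if "S \<subseteq> {1..nL}" for S
    using scale [OF that] \<rho>0 by simp

  have hub: "A' i j = A i j" if i: "i \<in> {1..nL}" and j: "j \<in> {1..nL}" and ij: "i \<noteq> j" for i j
  proof -
    obtain k where k: "k \<in> {nL+1..n}" "A i k \<noteq> A j k"
      using assms(6) i j ij by blast
    have sum3: "(\<Sum>l\<in>insert 0 {i, j}. f l) = f 0 + (f i + f j)" for f :: "nat \<Rightarrow> real"
      using i j ij by simp
    have sub: "{i, j} \<subseteq> {1..nL}" "{k} \<subseteq> {nL+1..n}" using i j k(1) by auto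
    \<comment> \<open>The null terms cancel, and rows \<open>i\<close> and \<open>j\<close> are
      already known at \<open>k\<close>, so two linear equations remain for the two hub
      weights.\<close>
    have "?w i {i, j} + ?w j {i, j} = ?w' i {i, j} + ?w' j {i, j}"
      using mix [OF sub(1), of "{}"] unfolding sum3 null_weight [OF sub(1)] by simp
    moreover
    have "?w i {i, j} * A i k + ?w j {i, j} * A j k = ?w' i {i, j} * A i k + ?w' j {i, j} * A j k"
      using mix [OF sub] row [OF i k(1)] row [OF j k(1)] null [OF k(1)]
      unfolding sum3 null_weight [OF sub(1)] by simp
    ultimately have "?w' i {i, j} = ?w i {i, j}"
      using k(2) by (rule two_point_weights_unique)
    then have "?w' i {j, i} = ?w i {j, i}" by (simp add: insert_commute)
    then show ?thesis
      using hub_entry_unique [of "{i}" nL j \<rho>' A' i \<rho> A]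
        i j ij single [OF i] pos [OF i] nonneg [of i "{j, i}"] by simp
  qed

  have entries: "A' i j = A i j" if "i \<in> {0..nL}" "j \<in> {1..n}" for i j
  proof (cases "j \<in> {1..nL}")
    case True
    then show ?thesis using null_hub [of j] hub [of i j] diag that by (cases "i = 0"; cases "i = j") auto
  next
    case False
    then show ?thesis using null [of j] row [of i j] that by (cases "i = 0") auto
  qed
  have "\<rho>' i = \<rho> i" if "i \<in> {0..nL}" for i
  proof (cases "i = 0")
    case False
    then have i: "i \<in> {1..nL}" using that by simp
    \<comment> \<open>Since \<open>A i i = 1\<close>, the weight of \<open>i\<close> at the pattern
      \<open>{i}\<close> is the mixing proportion times this positive product, which can be
      cancelled.\<close>
    have "(\<Prod>j\<in>{1..nL} - {i}. 1 - A' i j) = (\<Prod>j\<in>{1..nL} - {i}. 1 - A i j)"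
      using hub [OF i] by (intro prod.cong) auto
    then have "\<rho>' i * (\<Prod>j\<in>{1..nL} - {i}. 1 - A i j) = \<rho> i * (\<Prod>j\<in>{1..nL} - {i}. 1 - A i j)"
      using single [OF i] diag i by (simp add: hub_weight_def del: mult_cancel_right)
    then show ?thesis using absent_pos [OF that] by (metis mult_right_cancel less_irrefl)
  qed (simp add: \<rho>0)
  then have "\<rho>' = \<rho>"
    using par par' by (intro PiE_ext [of \<rho>' "{0..nL}" "\<lambda>_. {0..1}"]) (auto simp: hub_params_def)
  moreover have "A' = A"
  proof (rule PiE_ext)
    show A: "A' \<in> {0..nL} \<rightarrow>\<^sub>E ({1..n} \<rightarrow>\<^sub>E {0..1})" "A \<in> {0..nL} \<rightarrow>\<^sub>E ({1..n} \<rightarrow>\<^sub>E {0..1})"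
      using par par' by (auto simp: hub_params_def)
    show "A' i = A i" if "i \<in> {0..nL}" for i
      using PiE_mem [OF A(1) that] PiE_mem [OF A(2) that] entries [OF that] by (rule PiE_ext)
  qed
  ultimately show "\<theta>' = (\<rho>, A)" by (simp add: \<theta>')
qed

end
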